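(* Let $(X,X_+)$ be a pre-Riesz space. Then a linear projection $P: X \to X$ is an order projection if and only if it is a band projection.
   Context: A partially ordered vector space $(X,X_+)$ is a real vector space $X$ together with a cone $X_+ \subseteq X$, meaning $\alpha X_+ + \beta X_+ \subseteq X_+$ for all scalars $\alpha,\beta \in [0,\infty)$ and $X_+ \cap (-X_+) = \{0\}$; the order is $x \le y$ if and only if $y - x \in X_+$. For $S \subseteq X$, let $S^{\mathrm{u}} := \{z \in X : z \ge x \text{ for all } x \in S\}$ be the set of upper bounds of $S$. The space $(X,X_+)$ is called a pre-Riesz space (van Haandel) if for all $x,y,z \in X$ the inclusion $\{x+y,x+z\}^{\mathrm{u}} \subseteq \{y,z\}^{\mathrm{u}}$ implies $x \in X_+$. (Every pre-Riesz space has generating cone, i.e. $X = X_+ - X_+$, and every Archimedean partially ordered vector space with generating cone is pre-Riesz.) Two vectors $x,y \in X$ are disjoint, written $x \perp y$, if $\{x+y,-x-y\}^{\mathrm{u}} = \{x-y,y-x\}^{\mathrm{u}}$. The disjoint complement of $S \subseteq X$ is $S^\perp := \{x \in X : x \perp y \text{ for all } y \in S\}$; in a pre-Riesz space it is known that $S^\perp$ is always a vector subspace of $X$. A subset $B \subseteq X$ is a band if $B^{\perp\perp} := (B^\perp)^\perp = B$. A band $B$ is a projection band if $X = B \oplus B^\perp$. A linear projection is a linear map $P$ with $P^2 = P$. A linear projection $P: X \to X$ is a band projection if there exists a projection band $B \subseteq X$ such that $P$ is the projection onto $B$ along $B^\perp$. A linear operator on $X$ is positive if it maps $X_+$ into $X_+$.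 A linear projection $P: X \to X$ is an order projection if both $P$ and $I - P$ are positive, where $I$ is the identity operator on $X$. *)

theory Defs
  imports Complex_Main
begin

text \<open>The vector space is a type of class \<open>real_vector\<close>; the positive cone \<open>K\<close> is an explicit
  set, so that a statement about \<open>K\<close> covers every partial order making the given space a
  partially ordered vector space.\<close>

locale partially_ordered_vector_space =
  fixes K :: "'a::real_vector set"
  assumes cone_combination:
      "\<lbrakk>0 \<le> \<alpha>; 0 \<le> \<beta>; x \<in> K; y \<in> K\<rbrakk> \<Longrightarrow> \<alpha> *\<^sub>R x + \<beta> *\<^sub>R y \<in> K"
    and cone_pointed: "K \<inter> uminus ` K = {0}"

definition cone_le :: "'a::real_vector set \<Rightarrow> 'a \<Rightarrow> 'a \<Rightarrow> bool" where
  "cone_le K x y \<longleftrightarrow> y - x \<in> K"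

definition upper_bounds :: "'a::real_vector set \<Rightarrow> 'a set \<Rightarrow> 'a set" where
  "upper_bounds K S = {z. \<forall>x\<in>S. cone_le K x z}"

locale pre_riesz_space = partially_ordered_vector_space +
  assumes pre_riesz:
    "upper_bounds K {x + y, x + z} \<subseteq> upper_bounds K {y, z} \<Longrightarrow> x \<in> K"

definition disjoint_vectors :: "'a::real_vector set \<Rightarrow> 'a \<Rightarrow> 'a \<Rightarrow> bool" where
  "disjoint_vectors K x y \<longleftrightarrow>
     upper_bounds K {x + y, - x - y} = upper_bounds K {x - y, y - x}"

definition disjoint_complement :: "'a::real_vector set \<Rightarrow> 'a set \<Rightarrow> 'a set" where
  "disjoint_complement K S = {x. \<forall>y\<in>S. disjoint_vectors K x y}"

definition band :: "'a::real_vector set \<Rightarrow> 'a set \<Rightarrow> bool" where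
  "band K B \<longleftrightarrow> disjoint_complement K (disjoint_complement K B) = B"

definition internal_direct_sum :: "'a::real_vector set \<Rightarrow> 'a set \<Rightarrow> bool" where
  "internal_direct_sum V W \<longleftrightarrow>
     subspace V \<and> subspace W \<and> V \<inter> W = {0} \<and> {v + w | v w. v \<in> V \<and> w \<in> W} = UNIV"

definition projection_band :: "'a::real_vector set \<Rightarrow> 'a set \<Rightarrow> bool" where
  "projection_band K B \<longleftrightarrow> band K B \<and> internal_direct_sum B (disjoint_complement K B)"

definition linear_projection :: "('a::real_vector \<Rightarrow> 'a) \<Rightarrow> bool" where
  "linear_projection P \<longleftrightarrow> linear P \<and> P \<circ> P = P"

definition projection_onto_along ::
    "('a::real_vector \<Rightarrow> 'a) \<Rightarrow> 'a set \<Rightarrow> 'a set \<Rightarrow> bool" where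
  "projection_onto_along P V W \<longleftrightarrow>
     linear_projection P \<and> range P = V \<and> {x. P x = 0} = W"

definition band_projection :: "'a::real_vector set \<Rightarrow> ('a \<Rightarrow> 'a) \<Rightarrow> bool" where
  "band_projection K P \<longleftrightarrow>
     linear_projection P \<and>
     (\<exists>B. projection_band K B \<and> projection_onto_along P B (disjoint_complement K B))"

definition positive_operator :: "'a::real_vector set \<Rightarrow> ('a \<Rightarrow> 'a) \<Rightarrow> bool" where
  "positive_operator K T \<longleftrightarrow> linear T \<and> T ` K \<subseteq> K"

definition order_projection :: "'a::real_vector set \<Rightarrow> ('a \<Rightarrow> 'a) \<Rightarrow> bool" where
  "order_projection K P \<longleftrightarrow>
     linear_projection P \<and> positive_operator K P \<and> positive_operator K (\<lambda>x. x - P x)"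

end

theory Submission
  imports Defs
begin

text \<open>Let \<open>P\<close> be an order projection and \<open>Q = I - P\<close>. Positivity of \<open>P\<close> and \<open>Q\<close> means that the
  cone splits as \<open>P K \<oplus> Q K\<close>, so inequalities may be checked separately on the \<open>P\<close>-part and on
  the \<open>Q\<close>-part. A vector \<open>v = p + q\<close> satisfies \<open>v \<le> z\<close> and \<open>- v \<le> z\<close> iff \<open>\<plusminus> p \<le> P z\<close> and
  \<open>\<plusminus> q \<le> Q z\<close>, and this does not change when the sign of \<open>q\<close> is flipped: the kernel of \<open>P\<close> is
  disjoint from its range. Conversely, suppose that \<open>v\<close> is disjoint from the range, in particular
  from \<open>p\<close>, so that \<open>\<plusminus> (2 p + q)\<close> and \<open>\<plusminus> q\<close> have the same upper bounds. A pre-Riesz space is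
  directed, hence \<open>\<plusminus> q\<close> have an upper bound \<open>w\<close>, and \<open>Q w\<close> is another one. Applying \<open>P\<close> to
  \<open>\<plusminus> (2 p + q) \<le> Q w\<close> yields \<open>\<plusminus> 2 p \<le> 0\<close>, that is, \<open>p = 0\<close>. Thus the disjoint complement of the
  range of \<open>P\<close> is the kernel of \<open>P\<close>; by the same argument for \<open>Q\<close>, the disjoint complement of the
  kernel is the range, so the range is a projection band.

  For a band projection \<open>P\<close> and \<open>x \<ge> 0\<close>, the vectors \<open>p = P x\<close> and \<open>q = x - P x\<close> are disjoint, and
  \<open>x = p + q\<close> is an upper bound of \<open>\<plusminus> (p + q)\<close>. Hence it is one of \<open>\<plusminus> (p - q)\<close>, which says
  \<open>2 q \<ge> 0\<close> and \<open>2 p \<ge> 0\<close>.\<close>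

context partially_ordered_vector_space
begin

lemma cone_zero: "0 \<in> K"
  using cone_pointed by blast

lemma cone_add: "x \<in> K \<Longrightarrow> y \<in> K \<Longrightarrow> x + y \<in> K"
  using cone_combination[of 1 1 x y] by simp

lemma cone_scaleR: "0 \<le> c \<Longrightarrow> x \<in> K \<Longrightarrow> c *\<^sub>R x \<in> K"
  using cone_combination[of c 0 x x] by simp

lemma cone_halve: "x + x \<in> K \<Longrightarrow> x \<in> K"
  using cone_scaleR[of "1/2" "x + x"] by (simp flip: scaleR_2)

lemma cone_antisym:
  assumes "x \<in> K" "- x \<in> K"
  shows "x = 0"
proof -
  have "x \<in> K \<inter> uminus ` K"
    using assms by (auto intro: image_eqI[of x uminus "- x"])
  then show ?thesis
    using cone_pointed by simp
qed

lemma positive_sum_of_disjoint: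
  assumes "disjoint_vectors K x y" and "x + y \<in> K"
  shows "x \<in> K" and "y \<in> K"
proof -
  have "x + y + (x + y) \<in> K"
    by (rule cone_add[OF assms(2) assms(2)])
  then have "x + y \<in> upper_bounds K {x + y, - x - y}"
    using cone_zero by (simp add: upper_bounds_def cone_le_def algebra_simps)
  then have "x + y \<in> upper_bounds K {x - y, y - x}"
    using assms(1) by (simp add: disjoint_vectors_def)
  then have "x + y - (y - x) \<in> K" "x + y - (x - y) \<in> K"
    by (simp_all add: upper_bounds_def cone_le_def)
  then have "x + x \<in> K" "y + y \<in> K"
    by (simp_all add: algebra_simps)
  then show "x \<in> K" "y \<in> K"
    by (blast dest: cone_halve)+
qed

lemma band_projection_imp_order_projection:
  assumes "band_projection K P"
  shows "order_projection K P"
proof -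
  from assms obtain B where proj: "linear_projection P"
    and "projection_onto_along P B (disjoint_complement K B)"
    by (auto simp: band_projection_def)
  then have range: "range P = B" and ker: "{x. P x = 0} = disjoint_complement K B"
    by (simp_all add: projection_onto_along_def)
  have lin: "linear P" and idem: "P (P x) = P x" for x
    using proj by (auto simp: linear_projection_def fun_eq_iff)
  have disj: "disjoint_vectors K (x - P x) (P x)" for x
  proof -
    have "P (x - P x) = 0"
      by (simp add: linear_diff[OF lin] idem)
    then have "x - P x \<in> disjoint_complement K B"
      using ker by blast
    then show ?thesis
      using range by (auto simp: disjoint_complement_def)
  qed
  have "P x \<in> K" "x - P x \<in> K" if "x \<in> K" for x
    using positive_sum_of_disjoint[OF disj[of x]] that by simp_all
  moreover have "linear (\<lambda>x. x - P x)"
    using lin by (intro linear_compose_sub linear_ident)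
  ultimately show ?thesis
    using proj lin by (auto simp: order_projection_def positive_operator_def)
qed

end

lemma order_projection_complement:
  assumes "order_projection K P"
  shows "order_projection K (\<lambda>x. x - P x)"
proof -
  have "linear P" "P \<circ> P = P"
    using assms by (auto simp: order_projection_def linear_projection_def)
  then have "(\<lambda>x. x - P x) \<circ> (\<lambda>x. x - P x) = (\<lambda>x. x - P x)"
    by (simp add: fun_eq_iff linear_diff)
  then show ?thesis
    using assms by (simp add: order_projection_def linear_projection_def positive_operator_def)
qed

context pre_riesz_space
begin

text \<open>Without an upper bound of \<open>\<plusminus> q\<close> the left-hand side of the pre-Riesz condition for
  \<open>y = q\<close>, \<open>z = - q\<close> is empty for every \<open>x\<close>, which forces the cone to be the whole space.\<close>

lemma ex_upper_bound_plus_minus: "\<exists>w. w - q \<in> K \<and> w + q \<in> K"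
proof (rule ccontr)
  assume none: "\<nexists>w. w - q \<in> K \<and> w + q \<in> K"
  have all: "x \<in> K" for x
  proof (rule pre_riesz)
    have "u \<notin> upper_bounds K {x + q, x + - q}" for u
      using none[simplified, rule_format, of "u - x"]
      by (auto simp: upper_bounds_def cone_le_def algebra_simps)
    then show "upper_bounds K {x + q, x + - q} \<subseteq> upper_bounds K {q, - q}"
      by blast
  qed
  then show False
    using none by blast
qed

lemma disjoint_complement_range_order_projection:
  assumes "order_projection K P"
  shows "disjoint_complement K (range P) = {x. P x = 0}"
proof (intro set_eqI iffI; (rule CollectI | drule CollectD)?)
  have lin: "linear P" and idem: "P (P x) = P x" for x
    using assms by (auto simp: order_projection_def linear_projection_def fun_eq_iff)
  note linP = linear_add[OF lin] linear_diff[OF lin] linear_neg[OF lin]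
  have split: "x \<in> K \<longleftrightarrow> P x \<in> K \<and> x - P x \<in> K" for x
    using assms cone_add[of "P x" "x - P x"]
    by (auto simp: order_projection_def positive_operator_def)
  {
    fix x assume "x \<in> disjoint_complement K (range P)"
    then have "disjoint_vectors K x (P x)"
      by (simp add: disjoint_complement_def)
    then have same: "upper_bounds K {x + P x, - x - P x} = upper_bounds K {x - P x, P x - x}"
      by (simp add: disjoint_vectors_def)
    obtain w where w: "w - (x - P x) \<in> K" "w + (x - P x) \<in> K"
      using ex_upper_bound_plus_minus by blast
    have "(w - P w) - (x - P x) \<in> K" "(w - P w) + (x - P x) \<in> K"
      using w split[of "w - (x - P x)"] split[of "w + (x - P x)"] by (simp_all add: linP idem algebra_simps)
    then have "w - P w \<in> upper_bounds K {x + P x, - x - P x}"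
      unfolding same by (simp add: upper_bounds_def cone_le_def algebra_simps)
    then have "(w - P w) - (x + P x) \<in> K" "(w - P w) - (- x - P x) \<in> K"
      by (simp_all add: upper_bounds_def cone_le_def)
    then have "P ((w - P w) - (x + P x)) \<in> K" "P ((w - P w) - (- x - P x)) \<in> K"
      using split by blast+
    then have "- (P x + P x) \<in> K" "P x + P x \<in> K"
      by (simp_all add: linP idem algebra_simps)
    then have "P x + P x = 0"
      using cone_antisym by blast
    then show "P x = 0"
      by (simp flip: scaleR_2)
  next
    fix x assume x: "P x = 0"
    have "disjoint_vectors K x (P y)" for y
    proof -
      have plus: "z \<in> upper_bounds K {x + P y, - x - P y} \<longleftrightarrow>
        P z - P y \<in> K \<and> P z + P y \<in> K \<and> z - P z - x \<in> K \<and> z - P z + x \<in> K" for z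
        using split[of "z - (x + P y)"] split[of "z - (- x - P y)"]
        by (auto simp: upper_bounds_def cone_le_def linP idem x algebra_simps)
      have minus: "z \<in> upper_bounds K {x - P y, P y - x} \<longleftrightarrow>
        P z - P y \<in> K \<and> P z + P y \<in> K \<and> z - P z - x \<in> K \<and> z - P z + x \<in> K" for z
        using split[of "z - (x - P y)"] split[of "z - (P y - x)"]
        by (auto simp: upper_bounds_def cone_le_def linP idem x algebra_simps)
      show ?thesis
        unfolding disjoint_vectors_def by (intro set_eqI) (simp only: plus minus)
    qed
    then show "x \<in> disjoint_complement K (range P)"
      by (auto simp: disjoint_complement_def)
  }
qed

lemma order_projection_imp_band_projection:
  assumes ord: "order_projection K P"
  shows "band_projection K P"
proof -
  have proj: "linear_projection P"
    using ord by (simp add: order_projection_def)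
  then have lin: "linear P" and idem: "P (P x) = P x" for x
    by (auto simp: linear_projection_def fun_eq_iff)
  have compl: "disjoint_complement K (range P) = {x. P x = 0}"
    by (rule disjoint_complement_range_order_projection[OF ord])
  have "range (\<lambda>x. x - P x) = {x. P x = 0}"
  proof (intro set_eqI iffI)
    fix x assume "x \<in> {x. P x = 0}"
    then show "x \<in> range (\<lambda>x. x - P x)"
      by (intro range_eqI[of _ _ x]) simp
  qed (auto simp: linear_diff[OF lin] idem)
  moreover have "{x. x - P x = 0} = range P"
    by (auto simp: idem intro: range_eqI)
  ultimately have "disjoint_complement K {x. P x = 0} = range P"
    using disjoint_complement_range_order_projection[OF order_projection_complement[OF ord]]
    by simp
  then have "band K (range P)"
    by (simp add: band_def compl)
  moreover have "internal_direct_sum (range P) {x. P x = 0}"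
    unfolding internal_direct_sum_def
  proof (intro conjI)
    show "subspace (range P)"
      by (rule linear_subspace_image[OF lin subspace_UNIV])
    show "subspace {x. P x = 0}"
      by (rule linear_subspace_kernel[OF lin])
    show "range P \<inter> {x. P x = 0} = {0}"
      using linear_0[OF lin] by (auto simp: idem intro: range_eqI[of 0 P 0])
    have "\<exists>v w. x = v + w \<and> v \<in> range P \<and> w \<in> {x. P x = 0}" for x
      by (rule exI[of _ "P x"], rule exI[of _ "x - P x"]) (simp add: linear_diff[OF lin] idem)
    then show "{v + w |v w. v \<in> range P \<and> w \<in> {x. P x = 0}} = UNIV"
      by blast
  qed
  ultimately have "projection_band K (range P)"
    by (simp add: projection_band_def compl)
  moreover have "projection_onto_along P (range P) (disjoint_complement K (range P))"
    by (simp add: projection_onto_along_def proj compl)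
  ultimately show ?thesis
    using proj by (auto simp: band_projection_def)
qed

end

theorem theorem3p2:
  fixes K :: "'a::real_vector set" and P :: "'a \<Rightarrow> 'a"
  assumes "pre_riesz_space K"
    and "linear_projection P"
  shows "order_projection K P \<longleftrightarrow> band_projection K P"
proof -
  interpret pre_riesz_space K
    by (rule assms(1))
  show ?thesis
    using order_projection_imp_band_projection band_projection_imp_order_projection by blast
qed

end
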